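(* Let $A(t)=[a_{ij}(t)]$ be a real $m\times m$ matrix with non-negative diagonal elements such that, for all $t$, $$a_{ii}\ge\sum_{j\ne i}|a_{ij}|,\quad i=1,\dots,m\qquad\Big(\text{or } a_{ii}\ge\sum_{j\ne i}|a_{ji}|,\quad i=1,\dots,m\Big),$$ and $a_{ij}\le 0$ for $i\ne j$, $i,j=1,\dots,m$. Consider the scheme $$\frac{y^{n+1}-y^n}\tau+A(\sigma y^{n+1}+(1-\sigma)y^n)=\varphi^n,\quad n=0,1,\dots,\qquad y^0=u^0,$$ with $u^0\ge 0$ and $\varphi^n\ge 0$, $n=0,1,\dots$. Then $y^{n+1}\ge 0$, $n=0,1,\dots$, for any $\tau>0$ if $\sigma=1$, and, if $0\le\sigma<1$, under the time-step constraint $$\tau\le\frac1{1-\sigma}\Big(\max_{1\le i\le m}a_{ii}\Big)^{-1}.$$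
   Context: Inequalities between vectors of $\mathbb R^m$ are componentwise. $\tau>0$ is the time step, $t^n=n\tau$, $\varphi^n,u^0\in\mathbb R^m$, and in the step from $t^n$ to $t^{n+1}$ the matrix $A$ is e.g. $A=A(\sigma t^{n+1}+(1-\sigma)t^n)$; the time-step condition is required at each step. If $\max_i a_{ii}=0$, the time-step condition is void. *)

theory Defs
  imports "HOL-Analysis.Analysis"
begin

definition row_diag_dominant :: "real ^ 'm ^ 'm \<Rightarrow> bool" where
  "row_diag_dominant A \<longleftrightarrow> (\<forall>i. A $ i $ i \<ge> (\<Sum>j \<in> UNIV - {i}. \<bar>A $ i $ j\<bar>))"

definition col_diag_dominant :: "real ^ 'm ^ 'm \<Rightarrow> bool" where
  "col_diag_dominant A \<longleftrightarrow> (\<forall>i. A $ i $ i \<ge> (\<Sum>j \<in> UNIV - {i}. \<bar>A $ j $ i\<bar>))"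

definition max_diag :: "real ^ 'm ^ 'm \<Rightarrow> real" where
  "max_diag A = Max (range (\<lambda>i. A $ i $ i))"

text \<open>
  The condition is void when the maximal diagonal entry is zero. This has to be said explicitly,
  because \<open>inverse 0 = 0\<close> would otherwise turn it into the unsatisfiable \<open>\<tau> \<le> 0\<close>.
\<close>

definition time_step_condition :: "real \<Rightarrow> real \<Rightarrow> real ^ 'm ^ 'm \<Rightarrow> bool" where
  "time_step_condition \<sigma> \<tau> A \<longleftrightarrow>
     (max_diag A \<noteq> 0 \<longrightarrow> \<tau> \<le> 1 / (1 - \<sigma>) * inverse (max_diag A))"

text \<open>
  In the step from \<open>n\<tau>\<close> to \<open>(n + 1)\<tau>\<close> the matrix is evaluated at the time \<open>s n\<close>,
  e.g. \<open>s n = \<sigma> (n + 1)\<tau> + (1 - \<sigma>) n\<tau>\<close>.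
\<close>

definition weighted_scheme ::
  "(real \<Rightarrow> real ^ 'm ^ 'm) \<Rightarrow> (nat \<Rightarrow> real) \<Rightarrow> real \<Rightarrow> real \<Rightarrow> (nat \<Rightarrow> real ^ 'm) \<Rightarrow> real ^ 'm
     \<Rightarrow> (nat \<Rightarrow> real ^ 'm) \<Rightarrow> bool" where
  "weighted_scheme A s \<sigma> \<tau> \<phi> u0 y \<longleftrightarrow>
     y 0 = u0 \<and>
     (\<forall>n. (y (Suc n) - y n) /\<^sub>R \<tau> + A (s n) *v (\<sigma> *\<^sub>R y (Suc n) + (1 - \<sigma>) *\<^sub>R y n) = \<phi> n)"

end

theory Submission
  imports Defs
begin

text \<open>
  One step reads \<open>(I + \<sigma>\<tau>A) y' = (I - (1 - \<sigma>)\<tau>A) y + \<tau>\<phi>\<close>. The time-step condition makes the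
  matrix on the right entrywise nonnegative, so the right-hand side is nonnegative. The matrix
  on the left is monotone: under row dominance one looks at the row where \<open>y'\<close> is minimal, and
  under column dominance one sums the rows over the set where \<open>y'\<close> is negative.
\<close>

lemma vec_nonneg_iff: "(0 :: real ^ 'm) \<le> x \<longleftrightarrow> (\<forall>i. 0 \<le> x $ i)"
  by (simp add: less_eq_vec_def)

lemma matrix_vector_mult_nth_split:
  fixes A :: "real ^ 'm ^ 'm"
  shows "(A *v x) $ i = A $ i $ i * x $ i + (\<Sum>j\<in>UNIV - {i}. A $ i $ j * x $ j)"
  by (simp add: matrix_vector_mult_def sum.remove[of UNIV i])

text \<open>Suppose the minimal entry \<open>w $ i\<close> is negative. Off-diagonal coefficients
  are nonpositive, so replacing each other \<open>w $ j\<close> by \<open>w $ i\<close> can only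
  increase row \<open>i\<close> of \<open>A *v w\<close>. This leaves the nonnegative row surplus
  times \<open>w $ i\<close>, so the identity part makes row \<open>i\<close> of the hypothesis
  strictly negative.\<close>

lemma row_dominant_monotone:
  fixes A :: "real ^ 'm ^ 'm" and w :: "real ^ 'm"
  assumes dom: "row_diag_dominant A"
    and off: "\<And>i j. i \<noteq> j \<Longrightarrow> A $ i $ j \<le> 0"
    and "0 \<le> c"
    and nonneg: "0 \<le> w + c *\<^sub>R (A *v w)"
  shows "0 \<le> w"
proof -
  have "Min (range (($) w)) \<in> range (($) w)"
    by (rule Min_in) auto
  then obtain i where i: "Min (range (($) w)) = w $ i"
    by blast
  have min: "w $ i \<le> w $ j" for j
    unfolding i[symmetric] by (rule Min_le) auto
  have "0 \<le> w $ i"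
  proof (rule ccontr)
    assume "\<not> 0 \<le> w $ i"
    then have neg: "w $ i < 0" by simp
    have "(\<Sum>j\<in>UNIV - {i}. A $ i $ j * w $ j) \<le> (\<Sum>j\<in>UNIV - {i}. - \<bar>A $ i $ j\<bar> * w $ i)"
    proof (rule sum_mono)
      fix j assume "j \<in> UNIV - {i}"
      then have "A $ i $ j \<le> 0" using off by auto
      then show "A $ i $ j * w $ j \<le> - \<bar>A $ i $ j\<bar> * w $ i"
        using mult_left_mono_neg[OF min[of j]] by simp
    qed
    then have "(A *v w) $ i \<le> (A $ i $ i - (\<Sum>j\<in>UNIV - {i}. \<bar>A $ i $ j\<bar>)) * w $ i"
      by (simp add: matrix_vector_mult_nth_split left_diff_distrib sum_distrib_right sum_negf)
    also have "\<dots> \<le> 0"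
      using dom neg by (intro mult_nonneg_nonpos) (auto simp: row_diag_dominant_def)
    finally have "c * (A *v w) $ i \<le> 0"
      using \<open>0 \<le> c\<close> by (rule mult_nonneg_nonpos[rotated])
    moreover have "0 \<le> w $ i + c * (A *v w) $ i"
      using nonneg by (simp add: vec_nonneg_iff)
    ultimately show False using neg by linarith
  qed
  then show ?thesis
    using min by (meson order_trans vec_nonneg_iff)
qed

text \<open>Summed over the rows in \<open>N\<close>, column \<open>j\<close> contributes its
  partial column sum times \<open>w $ j\<close>. The two factors have opposite signs: for
  \<open>j\<close> in \<open>N\<close> the sum contains the dominating diagonal entry, otherwise it
  has only off-diagonal entries.\<close>

lemma col_dominant_monotone:
  fixes A :: "real ^ 'm ^ 'm" and w :: "real ^ 'm"
  assumes dom: "col_diag_dominant A"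
    and off: "\<And>i j. i \<noteq> j \<Longrightarrow> A $ i $ j \<le> 0"
    and "0 \<le> c"
    and nonneg: "0 \<le> w + c *\<^sub>R (A *v w)"
  shows "0 \<le> w"
proof (rule ccontr)
  assume "\<not> 0 \<le> w"
  define N where "N = {i. w $ i < 0}"
  have "N \<noteq> {}"
    using \<open>\<not> 0 \<le> w\<close> by (auto simp: N_def vec_nonneg_iff not_le)
  have "(\<Sum>i\<in>N. A $ i $ j) * w $ j \<le> 0" for j
  proof (cases "j \<in> N")
    case True
    have "- (\<Sum>i\<in>N - {j}. A $ i $ j) = (\<Sum>i\<in>N - {j}. \<bar>A $ i $ j\<bar>)"
      using off by (auto simp flip: sum_negf intro!: sum.cong)
    also have "\<dots> \<le> (\<Sum>i\<in>UNIV - {j}. \<bar>A $ i $ j\<bar>)"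
      by (rule sum_mono2) auto
    also have "\<dots> \<le> A $ j $ j"
      using dom by (simp add: col_diag_dominant_def)
    finally have "0 \<le> (\<Sum>i\<in>N. A $ i $ j)"
      using True by (simp add: sum.remove[of N j])
    then show ?thesis
      using True by (auto simp: N_def intro: mult_nonneg_nonpos)
  next
    case False
    then have "(\<Sum>i\<in>N. A $ i $ j) \<le> 0"
      by (intro sum_nonpos off) auto
    then show ?thesis
      using False by (simp add: N_def mult_nonpos_nonneg)
  qed
  then have "(\<Sum>j\<in>UNIV. (\<Sum>i\<in>N. A $ i $ j) * w $ j) \<le> 0"
    by (rule sum_nonpos)
  \<comment> \<open>Exchanging the two sums passes from columns back to rows.\<close>
  also have "(\<Sum>j\<in>UNIV. (\<Sum>i\<in>N. A $ i $ j) * w $ j) = (\<Sum>i\<in>N. (A *v w) $ i)"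
    unfolding sum_distrib_right matrix_vector_mult_def by (subst sum.swap) simp
  finally have "(\<Sum>i\<in>N. (A *v w) $ i) \<le> 0" .
  then have "c * (\<Sum>i\<in>N. (A *v w) $ i) \<le> 0"
    using \<open>0 \<le> c\<close> by (simp add: mult_nonneg_nonpos)
  moreover have "0 \<le> (\<Sum>i\<in>N. w $ i + c * (A *v w) $ i)"
    using nonneg by (intro sum_nonneg) (simp add: vec_nonneg_iff)
  \<comment> \<open>Strictness comes from the identity part: \<open>N\<close> is nonempty and
    \<open>w\<close> is negative on it.\<close>
  moreover have "(\<Sum>i\<in>N. w $ i) < 0"
    using \<open>N \<noteq> {}\<close> by (intro sum_strict_mono[of N _ "\<lambda>_. 0", simplified]) (auto simp: N_def)
  ultimately show False
    unfolding sum.distrib sum_distrib_left[symmetric] by linarith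
qed

text \<open>The matrix \<open>I - d A\<close> has diagonal entries \<open>1 - d * A $ i $ i\<close>
  and off-diagonal entries \<open>- d * A $ i $ j\<close>, all nonnegative.\<close>

lemma explicit_part_nonneg:
  fixes A :: "real ^ 'm ^ 'm" and v :: "real ^ 'm"
  assumes off: "\<And>i j. i \<noteq> j \<Longrightarrow> A $ i $ j \<le> 0"
    and "0 \<le> d"
    and diag: "\<And>i. d * A $ i $ i \<le> 1"
    and "0 \<le> v"
  shows "0 \<le> v - d *\<^sub>R (A *v v)"
proof -
  have "0 \<le> v $ i - d * (A *v v) $ i" for i
  proof -
    have v: "0 \<le> v $ j" for j
      using \<open>0 \<le> v\<close> by (simp add: vec_nonneg_iff)
    have "(\<Sum>j\<in>UNIV - {i}. A $ i $ j * v $ j) \<le> 0"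
      using off v by (intro sum_nonpos mult_nonpos_nonneg) auto
    then have "d * (\<Sum>j\<in>UNIV - {i}. A $ i $ j * v $ j) \<le> 0"
      using \<open>0 \<le> d\<close> by (simp add: mult_nonneg_nonpos)
    moreover have "d * A $ i $ i * v $ i \<le> v $ i"
      using mult_right_mono[OF diag v] by simp
    ultimately show ?thesis
      by (simp add: matrix_vector_mult_nth_split distrib_left mult.assoc)
  qed
  then show ?thesis by (simp add: vec_nonneg_iff)
qed

lemma time_step_condition_diag:
  fixes A :: "real ^ 'm ^ 'm"
  assumes "time_step_condition \<sigma> \<tau> A" "0 < \<tau>" "\<sigma> < 1" "\<And>i. 0 \<le> A $ i $ i"
  shows "(1 - \<sigma>) * \<tau> * A $ i $ i \<le> 1"
proof -
  have le: "A $ i $ i \<le> max_diag A"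
    unfolding max_diag_def by (rule Max_ge) auto
  have "(1 - \<sigma>) * \<tau> * max_diag A \<le> 1"
  \<comment> \<open>A zero maximum makes the left side vanish; otherwise the maximum is positive and
    the denominators can be cleared.\<close>
  proof (cases "max_diag A = 0")
    case False
    then have "0 < max_diag A"
      using le assms(4)[of i] by linarith
    then show ?thesis
      using assms False by (simp add: time_step_condition_def field_simps)
  qed simp
  moreover have "(1 - \<sigma>) * \<tau> * A $ i $ i \<le> (1 - \<sigma>) * \<tau> * max_diag A"
    using assms le by (intro mult_left_mono) auto
  ultimately show ?thesis by linarith
qed

text \<open>Multiply the scheme by \<open>\<tau>\<close> and separate the two time levels.\<close>

lemma weighted_scheme_step:
  assumes "weighted_scheme A s \<sigma> \<tau> \<phi> u0 y" "\<tau> \<noteq> 0"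
  shows "y (Suc n) + (\<sigma> * \<tau>) *\<^sub>R (A (s n) *v y (Suc n))
    = (y n - ((1 - \<sigma>) * \<tau>) *\<^sub>R (A (s n) *v y n)) + \<tau> *\<^sub>R \<phi> n"
proof -
  have "\<phi> n = (y (Suc n) - y n) /\<^sub>R \<tau> + A (s n) *v (\<sigma> *\<^sub>R y (Suc n) + (1 - \<sigma>) *\<^sub>R y n)"
    using assms(1) by (simp add: weighted_scheme_def)
  then show ?thesis
    using \<open>\<tau> \<noteq> 0\<close>
    by (simp add: matrix_vector_right_distrib matrix_vector_mult_scaleR scaleR_right_distrib mult.commute)
qed

theorem theorem24:
  fixes A :: "real \<Rightarrow> real ^ 'm ^ 'm"
    and s :: "nat \<Rightarrow> real"
    and \<sigma> \<tau> :: real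
    and \<phi> y :: "nat \<Rightarrow> real ^ 'm"
    and u0 :: "real ^ 'm"
  assumes diag_nonneg: "\<And>t i. t \<ge> 0 \<Longrightarrow> A t $ i $ i \<ge> 0"
    and dominant: "\<And>t. t \<ge> 0 \<Longrightarrow> row_diag_dominant (A t) \<or> col_diag_dominant (A t)"
    and offdiag_nonpos: "\<And>t i j. t \<ge> 0 \<Longrightarrow> i \<noteq> j \<Longrightarrow> A t $ i $ j \<le> 0"
    and tau_pos: "\<tau> > 0"
    and eval_time: "\<And>n. s n \<in> {real n * \<tau> .. real (Suc n) * \<tau>}"
    and scheme: "weighted_scheme A s \<sigma> \<tau> \<phi> u0 y"
    and u0_nonneg: "u0 \<ge> 0"
    and phi_nonneg: "\<And>n. \<phi> n \<ge> 0"
    and sigma: "\<sigma> = 1 \<or> (0 \<le> \<sigma> \<and> \<sigma> < 1 \<and> (\<forall>n. time_step_condition \<sigma> \<tau> (A (s n))))"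
  shows "\<forall>n. y (Suc n) \<ge> 0"
proof -
  \<comment> \<open>The conditions on \<open>A\<close> are given for nonnegative times, so the
    evaluation times must be placed there.\<close>
  have sn: "0 \<le> s n" for n
  proof -
    have "0 \<le> real n * \<tau>" using tau_pos by simp
    also have "\<dots> \<le> s n" using eval_time[of n] by simp
    finally show ?thesis .
  qed
  \<comment> \<open>For \<open>\<sigma> = 1\<close> the left side is 0, so both cases of
    \<open>sigma\<close> can be treated together from here on.\<close>
  have explicit: "(1 - \<sigma>) * \<tau> * A (s n) $ i $ i \<le> 1" for n i
    using sigma time_step_condition_diag[of \<sigma> \<tau> "A (s n)" i] tau_pos diag_nonneg[OF sn] by auto
  have step: "0 \<le> y (Suc n)" if "0 \<le> y n" for n
  proof -
    have "0 \<le> y n - ((1 - \<sigma>) * \<tau>) *\<^sub>R (A (s n) *v y n)"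
      using offdiag_nonpos[OF sn] explicit that sigma tau_pos by (intro explicit_part_nonneg) auto
    moreover have "0 \<le> \<tau> *\<^sub>R \<phi> n"
      using phi_nonneg[of n] tau_pos by (simp add: vec_nonneg_iff)
    ultimately have "0 \<le> y (Suc n) + (\<sigma> * \<tau>) *\<^sub>R (A (s n) *v y (Suc n))"
      using weighted_scheme_step[OF scheme, of n] tau_pos
      by (simp add: vec_nonneg_iff)
    moreover have "0 \<le> \<sigma> * \<tau>"
      using sigma tau_pos by auto
    \<comment> \<open>The kind of dominance may change from step to step; either one gives
      monotonicity with \<open>c = \<sigma> * \<tau>\<close>.\<close>
    ultimately show ?thesis
      using dominant[OF sn, of n] offdiag_nonpos[OF sn]
        row_dominant_monotone col_dominant_monotone by blast
  qed
  \<comment> \<open>The induction starts from \<open>y 0 = u0\<close>.\<close>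
  have "0 \<le> y n" for n
    using scheme u0_nonneg by (induction n) (auto simp: weighted_scheme_def step)
  then show ?thesis by blast
qed

end
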